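(* Let $A=A_{st}+A_{\mathcal I}\epsilon\in\mathbb{DQ}^{n\times n}$ with $A_{st}\ne O$. Let $\lambda=\lambda_{st}+\lambda_{\mathcal I}\epsilon\in\mathbb{DQ}$ and $\mathbf{x}=\mathbf{x}_{st}+\mathbf{x}_{\mathcal I}\epsilon\in\mathbb{DQ}^n$. (i) $\lambda$ is a right eigenvalue of $A$ with right eigenvector $\mathbf{x}$ only if $\lambda_{st}$ is a right eigenvalue of the quaternion matrix $A_{st}$ with right eigenvector $\mathbf{x}_{st}$, i.e., $\mathbf{x}_{st}\ne\mathbf{0}$ and $$A_{st}\mathbf{x}_{st}=\mathbf{x}_{st}\lambda_{st};$$ in this case $$\lambda_{st}=\frac{\mathbf{x}_{st}^*A_{st}\mathbf{x}_{st}}{\mathbf{x}_{st}^*\mathbf{x}_{st}}.$$ (ii) Furthermore, if $\lambda_{st}$ is a right eigenvalue of the quaternion matrix $A_{st}$ with right eigenvector $\mathbf{x}_{st}$, then $\lambda$ is a right eigenvalue of $A$ with right eigenvector $\mathbf{x}$ if and only if $\lambda_{\mathcal I}$ and $\mathbf{x}_{\mathcal I}$ satisfy $$\mathbf{x}_{st}\lambda_{\mathcal I}=A_{\mathcal I}\mathbf{x}_{st}+A_{st}\mathbf{x}_{\mathcal I}-\mathbf{x}_{\mathcal I}\lambda_{st}.$$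
   Context: $\mathbb{Q}$ denotes the real quaternions and $q^*$ the quaternion conjugate. $\epsilon$ is the infinitesimal unit: $\epsilon\neq 0$, $\epsilon^2=0$, and $\epsilon$ commutes with all quaternions. A dual quaternion is $q=q_{st}+q_{\mathcal I}\epsilon$ with $q_{st},q_{\mathcal I}\in\mathbb{Q}$ (set $\mathbb{DQ}$); it is appreciable if $q_{st}\ne0$. Vectors and matrices over $\mathbb{DQ}$ are written $\mathbf{x}=\mathbf{x}_{st}+\mathbf{x}_{\mathcal I}\epsilon$, $A=A_{st}+A_{\mathcal I}\epsilon$ with quaternion parts; $^*$ denotes conjugate transpose. A vector in $\mathbb{DQ}^n$ is appreciable if at least one component is appreciable. Right eigenvalue of a quaternion matrix $A\in\mathbb{Q}^{n\times n}$: $\lambda\in\mathbb{Q}$ with $A\mathbf{x}=\mathbf{x}\lambda$ for some nonzero $\mathbf{x}\in\mathbb{Q}^n$ (an associated right eigenvector). Right eigenvalue of $A\in\mathbb{DQ}^{n\times n}$: $\lambda\in\mathbb{DQ}$ such that $A\mathbf{x}=\mathbf{x}\lambda$ for some appreciable $\mathbf{x}\in\mathbb{DQ}^n$ (an associated right eigenvector). For nonzero $\mathbf{x}\in\mathbb{Q}^n$, $\mathbf{x}^*\mathbf{x}$ is a positive real number and $\frac{\mathbf{x}^*A\mathbf{x}}{\mathbf{x}^*\mathbf{x}}$ means $(\mathbf{x}^*\mathbf{x})^{-1}(\mathbf{x}^*A\mathbf{x})$. *)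

theory Defs
  imports "HOL-Analysis.Finite_Cartesian_Product"
begin

datatype quat = Quat (qRe: real) (qIm1: real) (qIm2: real) (qIm3: real)

lemma quat_eq_iff:
  "p = q \<longleftrightarrow> qRe p = qRe q \<and> qIm1 p = qIm1 q \<and> qIm2 p = qIm2 q \<and> qIm3 p = qIm3 q"
  by (auto intro: quat.expand)

definition qcnj :: "quat \<Rightarrow> quat" where
  "qcnj q = Quat (qRe q) (- qIm1 q) (- qIm2 q) (- qIm3 q)"

lemma qcnj_sel [simp]:
  "qRe (qcnj q) = qRe q" "qIm1 (qcnj q) = - qIm1 q"
  "qIm2 (qcnj q) = - qIm2 q" "qIm3 (qcnj q) = - qIm3 q"
  by (simp_all add: qcnj_def)

instantiation quat :: division_ring
begin

definition zero_quat where "0 = Quat 0 0 0 0"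
definition one_quat where "1 = Quat 1 0 0 0"
definition plus_quat where
  "p + q = Quat (qRe p + qRe q) (qIm1 p + qIm1 q) (qIm2 p + qIm2 q) (qIm3 p + qIm3 q)"
definition uminus_quat where
  "- q = Quat (- qRe q) (- qIm1 q) (- qIm2 q) (- qIm3 q)"
definition minus_quat where
  "p - q = Quat (qRe p - qRe q) (qIm1 p - qIm1 q) (qIm2 p - qIm2 q) (qIm3 p - qIm3 q)"
definition times_quat where
  "p * q = Quat
     (qRe p * qRe q - qIm1 p * qIm1 q - qIm2 p * qIm2 q - qIm3 p * qIm3 q)
     (qRe p * qIm1 q + qIm1 p * qRe q + qIm2 p * qIm3 q - qIm3 p * qIm2 q)
     (qRe p * qIm2 q - qIm1 p * qIm3 q + qIm2 p * qRe q + qIm3 p * qIm1 q)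
     (qRe p * qIm3 q + qIm1 p * qIm2 q - qIm2 p * qIm1 q + qIm3 p * qRe q)"
definition inverse_quat where
  "inverse q = (let s = (qRe q)\<^sup>2 + (qIm1 q)\<^sup>2 + (qIm2 q)\<^sup>2 + (qIm3 q)\<^sup>2
     in Quat (qRe q / s) (- qIm1 q / s) (- qIm2 q / s) (- qIm3 q / s))"
definition divide_quat where "p div q = p * inverse (q :: quat)"

lemma quat_sel [simp]:
  "qRe 0 = 0" "qIm1 0 = 0" "qIm2 0 = 0" "qIm3 0 = 0"
  "qRe 1 = 1" "qIm1 1 = 0" "qIm2 1 = 0" "qIm3 1 = 0"
  "qRe (p + q) = qRe p + qRe q" "qIm1 (p + q) = qIm1 p + qIm1 q"
  "qIm2 (p + q) = qIm2 p + qIm2 q" "qIm3 (p + q) = qIm3 p + qIm3 q"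
  "qRe (- q) = - qRe q" "qIm1 (- q) = - qIm1 q" "qIm2 (- q) = - qIm2 q" "qIm3 (- q) = - qIm3 q"
  "qRe (p - q) = qRe p - qRe q" "qIm1 (p - q) = qIm1 p - qIm1 q"
  "qIm2 (p - q) = qIm2 p - qIm2 q" "qIm3 (p - q) = qIm3 p - qIm3 q"
  "qRe (p * q) = qRe p * qRe q - qIm1 p * qIm1 q - qIm2 p * qIm2 q - qIm3 p * qIm3 q"
  "qIm1 (p * q) = qRe p * qIm1 q + qIm1 p * qRe q + qIm2 p * qIm3 q - qIm3 p * qIm2 q"
  "qIm2 (p * q) = qRe p * qIm2 q - qIm1 p * qIm3 q + qIm2 p * qRe q + qIm3 p * qIm1 q"
  "qIm3 (p * q) = qRe p * qIm3 q + qIm1 p * qIm2 q - qIm2 p * qIm1 q + qIm3 p * qRe q"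
  by (simp_all add: zero_quat_def one_quat_def plus_quat_def uminus_quat_def minus_quat_def
      times_quat_def)

lemma quat_sum_squares_pos:
  assumes "q \<noteq> (0 :: quat)"
  shows "(qRe q)\<^sup>2 + (qIm1 q)\<^sup>2 + (qIm2 q)\<^sup>2 + (qIm3 q)\<^sup>2 > 0"
proof -
  have "qRe q \<noteq> 0 \<or> qIm1 q \<noteq> 0 \<or> qIm2 q \<noteq> 0 \<or> qIm3 q \<noteq> 0"
    using assms by (simp add: quat_eq_iff)
  then have "(qRe q)\<^sup>2 > 0 \<or> (qIm1 q)\<^sup>2 > 0 \<or> (qIm2 q)\<^sup>2 > 0 \<or> (qIm3 q)\<^sup>2 > 0"
    by simp
  then show ?thesis
    using zero_le_power2[of "qRe q"] zero_le_power2[of "qIm1 q"]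
      zero_le_power2[of "qIm2 q"] zero_le_power2[of "qIm3 q"] by linarith
qed

instance
proof
  fix a b c :: quat
  show "a * b * c = a * (b * c)" "(a + b) * c = a * c + b * c" "a * (b + c) = a * b + a * c"
    by (simp_all add: quat_eq_iff algebra_simps)
  show "inverse a * a = 1" if "a \<noteq> 0"
    using quat_sum_squares_pos[OF that]
    by (simp add: quat_eq_iff inverse_quat_def Let_def power2_eq_square
        flip: add_divide_distrib diff_divide_distrib)
  show "a * inverse a = 1" if "a \<noteq> 0"
    using quat_sum_squares_pos[OF that]
    by (simp add: quat_eq_iff inverse_quat_def Let_def power2_eq_square
        flip: add_divide_distrib diff_divide_distrib)
qed (simp_all add: quat_eq_iff divide_quat_def inverse_quat_def)

end

lemma quat_units:
  defines "i \<equiv> Quat 0 1 0 0" and "j \<equiv> Quat 0 0 1 0" and "k \<equiv> Quat 0 0 0 1"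
  shows "i * i = -1" "j * j = -1" "k * k = -1" "i * j = k" "j * k = i" "k * i = j"
  by (simp_all add: assms quat_eq_iff)

text \<open>\<open>DQuat p q\<close> is the dual quaternion \<open>p + q \<epsilon>\<close>.\<close>

datatype dquat = DQuat (dq_st: quat) (dq_inf: quat)

lemma dquat_eq_iff: "p = q \<longleftrightarrow> dq_st p = dq_st q \<and> dq_inf p = dq_inf q"
  by (auto intro: dquat.expand)

instantiation dquat :: ring_1
begin

definition zero_dquat where "0 = DQuat 0 0"
definition one_dquat where "1 = DQuat 1 0"
definition plus_dquat where "p + q = DQuat (dq_st p + dq_st q) (dq_inf p + dq_inf q)"
definition uminus_dquat where "- q = DQuat (- dq_st q) (- dq_inf q)"
definition minus_dquat where "p - q = DQuat (dq_st p - dq_st q) (dq_inf p - dq_inf q)"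
definition times_dquat where
  "p * q = DQuat (dq_st p * dq_st q) (dq_st p * dq_inf q + dq_inf p * dq_st q)"

lemma dquat_sel [simp]:
  "dq_st 0 = 0" "dq_inf 0 = 0" "dq_st 1 = 1" "dq_inf 1 = 0"
  "dq_st (p + q) = dq_st p + dq_st q" "dq_inf (p + q) = dq_inf p + dq_inf q"
  "dq_st (- q) = - dq_st q" "dq_inf (- q) = - dq_inf q"
  "dq_st (p - q) = dq_st p - dq_st q" "dq_inf (p - q) = dq_inf p - dq_inf q"
  "dq_st (p * q) = dq_st p * dq_st q"
  "dq_inf (p * q) = dq_st p * dq_inf q + dq_inf p * dq_st q"
  by (simp_all add: zero_dquat_def one_dquat_def plus_dquat_def uminus_dquat_def
      minus_dquat_def times_dquat_def)

instance
  by standard (simp_all add: dquat_eq_iff algebra_simps)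

end

lemma dquat_eps:
  defines "\<epsilon> \<equiv> DQuat 0 1"
  shows "\<epsilon> \<noteq> 0" "\<epsilon> * \<epsilon> = 0" "\<epsilon> * DQuat q 0 = DQuat q 0 * \<epsilon>"
    "DQuat p q = DQuat p 0 + DQuat q 0 * \<epsilon>"
  by (simp_all add: assms dquat_eq_iff)

definition vec_st :: "dquat ^ 'n \<Rightarrow> quat ^ 'n" where
  "vec_st x = (\<chi> i. dq_st (x $ i))"

definition vec_inf :: "dquat ^ 'n \<Rightarrow> quat ^ 'n" where
  "vec_inf x = (\<chi> i. dq_inf (x $ i))"

definition mat_st :: "dquat ^ 'n ^ 'm \<Rightarrow> quat ^ 'n ^ 'm" where
  "mat_st A = (\<chi> i j. dq_st (A $ i $ j))"

definition mat_inf :: "dquat ^ 'n ^ 'm \<Rightarrow> quat ^ 'n ^ 'm" where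
  "mat_inf A = (\<chi> i j. dq_inf (A $ i $ j))"

definition appreciable :: "dquat \<Rightarrow> bool" where
  "appreciable q \<longleftrightarrow> dq_st q \<noteq> 0"

definition appreciable_vec :: "dquat ^ 'n \<Rightarrow> bool" where
  "appreciable_vec x \<longleftrightarrow> (\<exists>i. appreciable (x $ i))"

text \<open>The library multiplication \<open>*s\<close> puts the scalar on the left; here it is on the right.\<close>

definition vec_scale_right :: "'a::times ^ 'n \<Rightarrow> 'a \<Rightarrow> 'a ^ 'n" (infixl \<open>*r\<close> 75) where
  "x *r c = (\<chi> i. x $ i * c)"

text \<open>\<open>x\<^sup>* y\<close> for column vectors; thus \<open>x\<^sup>* A x\<close> is \<open>qdot x (A *v x)\<close>.\<close>

definition qdot :: "quat ^ 'n \<Rightarrow> quat ^ 'n \<Rightarrow> quat" where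
  "qdot x y = (\<Sum>i\<in>UNIV. qcnj (x $ i) * y $ i)"

text \<open>\<open>c\<close> is a right eigenvalue of \<open>A\<close> with associated right eigenvector \<open>x\<close>.\<close>

definition quat_right_eigenpair :: "quat ^ 'n ^ 'n \<Rightarrow> quat \<Rightarrow> quat ^ 'n \<Rightarrow> bool" where
  "quat_right_eigenpair A c x \<longleftrightarrow> x \<noteq> 0 \<and> A *v x = x *r c"

definition dquat_right_eigenpair :: "dquat ^ 'n ^ 'n \<Rightarrow> dquat \<Rightarrow> dquat ^ 'n \<Rightarrow> bool" where
  "dquat_right_eigenpair A c x \<longleftrightarrow> appreciable_vec x \<and> A *v x = x *r c"

end

theory Submission
  imports Defs
begin

text \<open>
  The equation \<open>A x = x \<lambda>\<close> over the dual quaternions splits into its standard and infinitesimal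
  parts. The standard part is the eigenvalue equation of \<open>A\<^sub>s\<^sub>t\<close>, and the infinitesimal part is
  \<open>A\<^sub>s\<^sub>t x\<^sub>I + A\<^sub>I x\<^sub>s\<^sub>t = x\<^sub>s\<^sub>t \<lambda>\<^sub>I + x\<^sub>I \<lambda>\<^sub>s\<^sub>t\<close>. The Rayleigh quotient formula comes from multiplying
  the standard part by \<open>x\<^sub>s\<^sub>t\<^sup>*\<close> on the left.
\<close>

lemma dq_st_sum: "dq_st (sum f S) = (\<Sum>i\<in>S. dq_st (f i))"
  by (induction S rule: infinite_finite_induct) simp_all

lemma dq_inf_sum: "dq_inf (sum f S) = (\<Sum>i\<in>S. dq_inf (f i))"
  by (induction S rule: infinite_finite_induct) simp_all

lemma qRe_sum: "qRe (sum f S) = (\<Sum>i\<in>S. qRe (f i))"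
  by (induction S rule: infinite_finite_induct) simp_all

lemma dquat_vec_eq_iff: "x = y \<longleftrightarrow> vec_st x = vec_st y \<and> vec_inf x = vec_inf y"
  by (auto simp: vec_eq_iff vec_st_def vec_inf_def dquat_eq_iff)

lemma vec_st_mult: "vec_st (A *v x) = mat_st A *v vec_st x"
  by (simp add: vec_eq_iff vec_st_def mat_st_def matrix_vector_mult_def dq_st_sum)

text \<open>Since \<epsilon> squares to zero, the product of the two infinitesimal parts drops out
  and only the cross terms remain.\<close>

lemma vec_inf_mult: "vec_inf (A *v x) = mat_inf A *v vec_st x + mat_st A *v vec_inf x"
  by (simp add: vec_eq_iff vec_st_def vec_inf_def mat_st_def mat_inf_def matrix_vector_mult_def
      dq_inf_sum sum.distrib add.commute)

lemma vec_st_scale_right: "vec_st (x *r c) = vec_st x *r dq_st c"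
  by (simp add: vec_eq_iff vec_st_def vec_scale_right_def)

lemma vec_inf_scale_right: "vec_inf (x *r c) = vec_st x *r dq_inf c + vec_inf x *r dq_st c"
  by (simp add: vec_eq_iff vec_st_def vec_inf_def vec_scale_right_def)

lemma appreciable_vec_iff: "appreciable_vec x \<longleftrightarrow> vec_st x \<noteq> 0"
  by (simp add: appreciable_vec_def appreciable_def vec_eq_iff vec_st_def)

text \<open>The scalar stands to the right of every factor, so associativity and distributivity
  suffice without commutativity.\<close>

lemma qdot_scale_right: "qdot x (y *r c) = qdot x y * c"
  by (simp add: qdot_def vec_scale_right_def sum_distrib_right mult.assoc)

text \<open>The real part of \<open>qcnj q * q\<close> is the squared norm of \<open>q\<close>, so a
  nonzero entry makes the real part of the sum positive. This permits cancelling
  \<open>qdot x x\<close> in the Rayleigh quotient.\<close>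

lemma qdot_self_nonzero:
  assumes "x \<noteq> 0"
  shows "qdot x x \<noteq> 0"
proof -
  let ?n = "\<lambda>q. (qRe q)\<^sup>2 + (qIm1 q)\<^sup>2 + (qIm2 q)\<^sup>2 + (qIm3 q)\<^sup>2"
  obtain k where "x $ k \<noteq> 0"
    using assms by (auto simp: vec_eq_iff)
  then have "0 < (\<Sum>i\<in>UNIV. ?n (x $ i))"
    by (intro sum_pos2[of _ k] quat_sum_squares_pos) simp_all
  also have "(\<Sum>i\<in>UNIV. ?n (x $ i)) = qRe (qdot x x)"
    by (simp add: qdot_def qRe_sum power2_eq_square)
  finally show ?thesis
    by auto
qed

lemma quat_right_eigenpair_Rayleigh:
  assumes "quat_right_eigenpair A c x"
  shows "c = inverse (qdot x x) * qdot x (A *v x)"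
  using assms
  by (simp add: quat_right_eigenpair_def qdot_scale_right qdot_self_nonzero flip: mult.assoc)

text \<open>Appreciability of \<open>x\<close> is exactly \<open>vec_st x \<noteq> 0\<close>, so the
  standard part of the equation becomes a full quaternion eigenpair. Both claims of the theorem are
  read off from this equivalence.\<close>

lemma dquat_right_eigenpair_iff:
  "dquat_right_eigenpair A l x \<longleftrightarrow>
     quat_right_eigenpair (mat_st A) (dq_st l) (vec_st x) \<and>
     vec_st x *r dq_inf l =
       mat_inf A *v vec_st x + mat_st A *v vec_inf x - vec_inf x *r dq_st l"
  by (auto simp: dquat_right_eigenpair_def quat_right_eigenpair_def appreciable_vec_iff
      dquat_vec_eq_iff vec_st_mult vec_inf_mult vec_st_scale_right vec_inf_scale_right
      eq_diff_eq)

theorem theorem3p2: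
  fixes A :: "dquat ^ 'n ^ 'n" and l :: dquat and x :: "dquat ^ 'n"
  assumes "mat_st A \<noteq> 0"
  shows "(dquat_right_eigenpair A l x \<longrightarrow>
            quat_right_eigenpair (mat_st A) (dq_st l) (vec_st x) \<and>
            vec_st x \<noteq> 0 \<and>
            mat_st A *v vec_st x = vec_st x *r dq_st l \<and>
            dq_st l = inverse (qdot (vec_st x) (vec_st x)) * qdot (vec_st x) (mat_st A *v vec_st x))
       \<and> (quat_right_eigenpair (mat_st A) (dq_st l) (vec_st x) \<longrightarrow>
            (dquat_right_eigenpair A l x \<longleftrightarrow>
               vec_st x *r dq_inf l =
                 mat_inf A *v vec_st x + mat_st A *v vec_inf x - vec_inf x *r dq_st l))"
  using quat_right_eigenpair_Rayleigh[of "mat_st A" "dq_st l" "vec_st x"]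
  by (auto simp: dquat_right_eigenpair_iff quat_right_eigenpair_def)

end
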